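(* Let $\{G(n)\}$ be a sequence of random intersection graphs with $n=O(m)$ and $\mathbb E\,Y(n)^2=O(1)$, and let $C=C(n)$ be the clique output by \textsc{Mono-Clique} on input $G(n)$. Then $\mathbb E\big(\omega(G(n))-|C|\big)^2=O(1)$. Furthermore, if there is a sequence $\omega_n\to\infty$ such that $\omega(G(n))\ge\omega_n$ with probability tending to $1$, then $|C|=\omega(G(n))$ with probability tending to $1$.
   Context: Random intersection graph: given positive integers $n,m$ and a probability measure $P$ on $\{0,\dots,m\}$, $G(n,m,P)$ has vertex set $V=[n]$ and attribute set $W=\{w_1,\dots,w_m\}$; independent random subsets $S_1,\dots,S_n\subseteq W$ with $\mathbb P(S_v=S)=P(|S|)/\binom{m}{|S|}$; distinct $u,v$ adjacent iff $S_u\cap S_v\ne\emptyset$. For a sequence $G(n)=G(n,m(n),P(n))$ with $m(n)\to\infty$, $X(n)$ has law $P(n)$ and $Y(n)=(n/m)^{1/2}X(n)$. $\omega$ is the clique number; $\Gamma(v)$ is the neighbourhood of $v$. Algorithm \textsc{Mono-Clique}$(G)$: for each edge $uv$ compute $D(uv)=|\Gamma(u)\cap\Gamma(v)|$; then go through the edges $uv$ in decreasing order of $D(uv)$ (ties broken arbitrarily), and for the first edge for which $S=\Gamma(u)\cap\Gamma(v)$ induces a clique, return $S\cup\{u,v\}$; if there is no such edge, return $\{1\}\cap V(G)$. *)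

theory Defs
  imports "HOL-Probability.Probability" "HOL-Library.Landau_Symbols"
begin

definition is_clique :: "nat set \<Rightarrow> (nat \<Rightarrow> nat \<Rightarrow> bool) \<Rightarrow> nat set \<Rightarrow> bool" where
  "is_clique V E K \<longleftrightarrow> K \<subseteq> V \<and> (\<forall>u\<in>K. \<forall>v\<in>K. u \<noteq> v \<longrightarrow> E u v)"

definition clique_number :: "nat set \<Rightarrow> (nat \<Rightarrow> nat \<Rightarrow> bool) \<Rightarrow> nat" where
  "clique_number V E = Max {card K | K. is_clique V E K}"

definition nbhd :: "nat set \<Rightarrow> (nat \<Rightarrow> nat \<Rightarrow> bool) \<Rightarrow> nat \<Rightarrow> nat set" where
  "nbhd V E v = {w \<in> V. E v w}"

definition graph_edges :: "nat set \<Rightarrow> (nat \<Rightarrow> nat \<Rightarrow> bool) \<Rightarrow> nat set set" where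
  "graph_edges V E = {{u, v} | u v. u \<in> V \<and> v \<in> V \<and> u \<noteq> v \<and> E u v}"

definition common_nbhd :: "nat set \<Rightarrow> (nat \<Rightarrow> nat \<Rightarrow> bool) \<Rightarrow> nat set \<Rightarrow> nat set" where
  "common_nbhd V E e = (\<Inter>x\<in>e. nbhd V E x) \<inter> V"

definition mono_clique_run :: "nat set \<Rightarrow> (nat \<Rightarrow> nat \<Rightarrow> bool) \<Rightarrow> nat set list \<Rightarrow> nat set" where
  "mono_clique_run V E es =
     (case find (\<lambda>e. is_clique V E (common_nbhd V E e)) es of
        Some e \<Rightarrow> common_nbhd V E e \<union> e
      | None \<Rightarrow> {1} \<inter> V)"

text \<open>All possible outputs of Mono-Clique: one for every admissible order, i.e. every
  enumeration of the edges in decreasing order of \<open>D(uv) = |\<Gamma>(u) \<inter> \<Gamma>(v)|\<close>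
  (ties broken arbitrarily).\<close>
definition mono_clique_outputs :: "nat set \<Rightarrow> (nat \<Rightarrow> nat \<Rightarrow> bool) \<Rightarrow> nat set set" where
  "mono_clique_outputs V E =
     {mono_clique_run V E es | es. distinct es \<and> set es = graph_edges V E \<and>
        sorted_wrt (\<lambda>e f. card (common_nbhd V E f) \<le> card (common_nbhd V E e)) es}"

text \<open>Random attribute set: \<open>P(S_v = S) = P(|S|) / binom m |S|\<close>, attributes \<open>W = {1..m}\<close>.\<close>
definition attr_pmf :: "nat \<Rightarrow> nat pmf \<Rightarrow> nat set pmf" where
  "attr_pmf m P = bind_pmf P (\<lambda>k. pmf_of_set {S. S \<subseteq> {1..m} \<and> card S = k})"

definition rig_pmf :: "nat \<Rightarrow> nat \<Rightarrow> nat pmf \<Rightarrow> (nat \<Rightarrow> nat set) pmf" where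
  "rig_pmf n m P = Pi_pmf {1..n} {} (\<lambda>_. attr_pmf m P)"

definition rig_adj :: "(nat \<Rightarrow> nat set) \<Rightarrow> nat \<Rightarrow> nat \<Rightarrow> bool" where
  "rig_adj S u v \<longleftrightarrow> u \<noteq> v \<and> S u \<inter> S v \<noteq> {}"

end

theory Submission
  imports Defs
begin

(* If an edge uv of a maximum clique K lies in no rainbow triangle (three vertices whose three pairs
   are joined by three distinct attributes) and u, v share only one attribute a, then every common
   neighbour of u and v has a. So the common neighbourhood of uv is a clique, and the algorithm
   returns at least |K| vertices. Hence, when it fails, all pairs in K are "entangled". Two given
   attributes lie in a given S_v with probability at most E X^2 / m^2, so with y = E Y^2 the expected
   number of entangled ordered pairs is at most y^2 + y^3 = O(1). This bounds the second moment of
   the clique number on the failure event, and Markov's inequality gives the second claim. *)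

section \<open>Cliques in finite graphs and the outputs of Mono-Clique\<close>

lemma sorted_wrt_find:
  assumes "sorted_wrt R xs" "find Q xs = Some y" "x \<in> set xs" "Q x" "reflp R"
  shows "R y x"
  using assms by (induction xs) (auto split: if_splits simp: reflp_def)

lemma finite_clique_cards:
  assumes "finite V"
  shows "finite {card K | K. is_clique V E K}"
proof -
  have "{card K | K. is_clique V E K} \<subseteq> card ` Pow V"
    by (auto simp: is_clique_def)
  then show ?thesis
    using assms by (meson finite_Pow_iff finite_imageI finite_subset)
qed

lemma clique_card_le_clique_number:
  assumes "finite V" "is_clique V E K"
  shows "card K \<le> clique_number V E"
  unfolding clique_number_def
  using assms(2) by (intro Max_ge finite_clique_cards[OF assms(1)]) auto

lemma obtain_maximum_clique:
  assumes "finite V"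
  obtains K where "is_clique V E K" "card K = clique_number V E"
proof -
  have "is_clique V E {}"
    by (simp add: is_clique_def)
  then have "{card K | K. is_clique V E K} \<noteq> {}"
    by blast
  from Max_in[OF finite_clique_cards[OF assms] this] show ?thesis
    using that unfolding clique_number_def by auto
qed

lemma mono_clique_output_is_clique:
  assumes "symp E" "C \<in> mono_clique_outputs V E"
  shows "is_clique V E C"
proof -
  obtain es where es: "C = mono_clique_run V E es" "set es = graph_edges V E"
    using assms(2) unfolding mono_clique_outputs_def by auto
  show ?thesis
  proof (cases "find (\<lambda>e. is_clique V E (common_nbhd V E e)) es")
    case None
    then show ?thesis
      by (auto simp: es mono_clique_run_def is_clique_def)
  next
    case (Some e)
    then have e: "e \<in> graph_edges V E" "is_clique V E (common_nbhd V E e)"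
      using es(2) by (auto simp: find_Some_iff)
    then obtain u v where uv: "e = {u, v}" "u \<in> V" "v \<in> V" "E u v"
      unfolding graph_edges_def by blast
    have "E u x \<and> E x u \<and> E v x \<and> E x v" if "x \<in> common_nbhd V E e" for x
      using that sympD[OF assms(1)] unfolding uv(1) common_nbhd_def nbhd_def by blast
    moreover have "common_nbhd V E e \<subseteq> V" "E v u"
      using sympD[OF assms(1)] uv by (auto simp: common_nbhd_def)
    ultimately have "is_clique V E (common_nbhd V E e \<union> e)"
      using e(2) uv unfolding is_clique_def by auto
    then show ?thesis
      unfolding es(1) mono_clique_run_def Some by simp
  qed
qed

text \<open>The edge f that the run selects comes no later in the order than any other edge whose
  common neighbourhood is a clique, so its D-value is at least that of e. Irreflexivity keeps the
  endpoints of f out of their common neighbourhood, so they add exactly 2.\<close>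

lemma mono_clique_output_card_ge:
  assumes "finite V" "irreflp E" "C \<in> mono_clique_outputs V E"
    and e: "e \<in> graph_edges V E" "is_clique V E (common_nbhd V E e)"
  shows "card (common_nbhd V E e) + 2 \<le> card C"
proof -
  let ?Q = "\<lambda>e. is_clique V E (common_nbhd V E e)"
  obtain es where es: "C = mono_clique_run V E es" "set es = graph_edges V E"
    "sorted_wrt (\<lambda>e f. card (common_nbhd V E f) \<le> card (common_nbhd V E e)) es"
    using assms(3) unfolding mono_clique_outputs_def by auto
  obtain f where f: "find ?Q es = Some f"
    using e es(2) by (cases "find ?Q es") (auto simp: find_None_iff)
  have le: "card (common_nbhd V E e) \<le> card (common_nbhd V E f)"
    using sorted_wrt_find[OF es(3) f, of e] e es(2) by (simp add: reflp_def)
  have "f \<in> graph_edges V E"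
    using f es(2) by (auto simp: find_Some_iff)
  then obtain u v where uv: "f = {u, v}" "u \<noteq> v"
    unfolding graph_edges_def by blast
  have "common_nbhd V E f \<inter> f = {}"
    using assms(2) by (auto simp: uv common_nbhd_def nbhd_def irreflp_def)
  moreover have "finite (common_nbhd V E f)"
    using assms(1) by (simp add: common_nbhd_def)
  ultimately have "card (common_nbhd V E f \<union> f) = card (common_nbhd V E f) + 2"
    using uv by (simp add: card_Un_disjoint)
  then show ?thesis
    using le by (simp add: es(1) mono_clique_run_def f)
qed

section \<open>Entangled pairs and a deterministic bound on the clique number\<close>

definition shares_two_attributes :: "nat set \<Rightarrow> (nat \<Rightarrow> nat set) \<Rightarrow> nat \<Rightarrow> nat \<Rightarrow> bool" where
  "shares_two_attributes W S u v \<longleftrightarrow>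
     (\<exists>a\<in>W. \<exists>b\<in>W. a \<noteq> b \<and> a \<in> S u \<and> b \<in> S u \<and> a \<in> S v \<and> b \<in> S v)"

text \<open>Since x differs from u and v, and \<open>entangled_pairs\<close> adds u \<noteq> v, the
  three conditions fall on independent attribute sets. Since a, b, c are distinct, each condition
  asks one set to contain two different attributes.\<close>

definition in_rainbow_triangle ::
    "nat set \<Rightarrow> nat set \<Rightarrow> (nat \<Rightarrow> nat set) \<Rightarrow> nat \<Rightarrow> nat \<Rightarrow> bool" where
  "in_rainbow_triangle V W S u v \<longleftrightarrow>
     (\<exists>x\<in>V - {u, v}. \<exists>a\<in>W. \<exists>b\<in>W. \<exists>c\<in>W. a \<noteq> b \<and> a \<noteq> c \<and> b \<noteq> c \<and>
        a \<in> S u \<and> b \<in> S u \<and> a \<in> S v \<and> c \<in> S v \<and> b \<in> S x \<and> c \<in> S x)"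

definition entangled_pairs :: "nat set \<Rightarrow> nat set \<Rightarrow> (nat \<Rightarrow> nat set) \<Rightarrow> (nat \<times> nat) set" where
  "entangled_pairs V W S = {(u, v) \<in> V \<times> V. u \<noteq> v \<and>
     (shares_two_attributes W S u v \<or> in_rainbow_triangle V W S u v)}"

lemma symp_rig_adj: "symp (rig_adj S)"
  by (auto simp: symp_def rig_adj_def)

lemma irreflp_rig_adj: "irreflp (rig_adj S)"
  by (auto simp: irreflp_def rig_adj_def)

text \<open>A common neighbour x that misses the shared attribute a meets \<open>S u\<close> in some
  b and \<open>S v\<close> in some c, both different from a. If b = c, then u and v share a and b;
  otherwise a, b, c form a rainbow triangle with x. So all common neighbours hold a and are pairwise
  adjacent.\<close>

lemma not_entangled_common_nbhd_clique:
  assumes S: "\<And>v. v \<in> V \<Longrightarrow> S v \<subseteq> W"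
    and uv: "u \<in> V" "v \<in> V" "rig_adj S u v" "(u, v) \<notin> entangled_pairs V W S"
  shows "is_clique V (rig_adj S) (common_nbhd V (rig_adj S) {u, v})"
proof -
  obtain a where a: "a \<in> S u" "a \<in> S v"
    using uv(3) by (auto simp: rig_adj_def)
  have "a \<in> S x" if x: "x \<in> common_nbhd V (rig_adj S) {u, v}" for x
  proof (rule ccontr)
    assume na: "a \<notin> S x"
    obtain b c where bc: "b \<in> S u" "b \<in> S x" "c \<in> S v" "c \<in> S x" "x \<in> V - {u, v}"
      using x by (auto simp: common_nbhd_def nbhd_def rig_adj_def)
    have ne: "a \<noteq> b" "a \<noteq> c"
      using na bc by auto
    have W: "a \<in> W" "b \<in> W" "c \<in> W"
      using S uv a bc by auto
    have "shares_two_attributes W S u v \<or> in_rainbow_triangle V W S u v"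
    proof (cases "b = c")
      case True
      then show ?thesis
        unfolding shares_two_attributes_def using a bc ne W by blast
    next
      case False
      then show ?thesis
        unfolding in_rainbow_triangle_def using a bc ne W by blast
    qed
    then show False
      using uv by (auto simp: entangled_pairs_def rig_adj_def)
  qed
  then show ?thesis
    by (auto simp: is_clique_def common_nbhd_def rig_adj_def)
qed

text \<open>One unentangled edge of a maximum clique K would give an output of size at least |K|. So
  on failure all off-diagonal pairs of K \<times> K are entangled, which bounds |K|^2 - |K| by their
  number.\<close>

lemma clique_number_square_le_entangled_pairs:
  assumes V: "finite V" and S: "\<And>v. v \<in> V \<Longrightarrow> S v \<subseteq> W"
    and C: "C \<in> mono_clique_outputs V (rig_adj S)"
    and ne: "card C \<noteq> clique_number V (rig_adj S)"
  shows "(clique_number V (rig_adj S))\<^sup>2 \<le> 2 * card (entangled_pairs V W S) + 1"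
proof -
  let ?E = "rig_adj S"
  obtain K where K: "is_clique V ?E K" "card K = clique_number V ?E"
    using obtain_maximum_clique[OF V] by blast
  have KV: "K \<subseteq> V"
    using K(1) by (simp add: is_clique_def)
  then have finK: "finite K"
    using V finite_subset by blast
  have lt: "card C < card K"
    using clique_card_le_clique_number[OF V mono_clique_output_is_clique[OF symp_rig_adj C]] ne K
    by simp
  have ent: "(u, v) \<in> entangled_pairs V W S" if "u \<in> K" "v \<in> K" "u \<noteq> v" for u v
  proof (rule ccontr)
    assume n: "(u, v) \<notin> entangled_pairs V W S"
    have uv: "u \<in> V" "v \<in> V" "?E u v"
      using that K KV by (auto simp: is_clique_def)
    then have e: "{u, v} \<in> graph_edges V ?E"
      using that unfolding graph_edges_def by blast
    have "K - {u, v} \<subseteq> common_nbhd V ?E {u, v}"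
      using K KV that by (auto simp: is_clique_def common_nbhd_def nbhd_def)
    then have "card (K - {u, v}) \<le> card (common_nbhd V ?E {u, v})"
      using V by (intro card_mono) (auto simp: common_nbhd_def)
    moreover have "card (K - {u, v}) = card K - 2"
      using that finK by (simp add: card_Diff_subset)
    moreover have "card (common_nbhd V ?E {u, v}) + 2 \<le> card C"
      by (intro mono_clique_output_card_ge V irreflp_rig_adj C e
          not_entangled_common_nbhd_clique[OF S uv n])
    ultimately show False
      using lt by linarith
  qed
  have fin: "finite (entangled_pairs V W S)"
    by (rule finite_subset[of _ "V \<times> V"]) (auto simp: entangled_pairs_def V)
  have "K \<times> K \<subseteq> entangled_pairs V W S \<union> (\<lambda>x. (x, x)) ` K"
    using ent by auto
  then have "card (K \<times> K) \<le> card (entangled_pairs V W S \<union> (\<lambda>x. (x, x)) ` K)"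
    using fin finK by (intro card_mono) auto
  also have "\<dots> \<le> card (entangled_pairs V W S) + card ((\<lambda>x. (x, x)) ` K)"
    by (rule card_Un_le)
  also have "\<dots> \<le> card (entangled_pairs V W S) + card K"
    using card_image_le[OF finK] by simp
  finally have "(card K)\<^sup>2 \<le> card (entangled_pairs V W S) + card K"
    by (simp add: card_cartesian_product power2_eq_square)
  \<comment> \<open>This is (|K| - 1)^2 \<ge> 0. It absorbs the linear term into half of |K|^2,
    which explains the factor 2 and the summand 1 in the bound.\<close>
  moreover have "2 * card K \<le> (card K)\<^sup>2 + 1"
    by (cases "card K") (auto simp: power2_eq_square)
  ultimately show ?thesis
    unfolding K(2)[symmetric] by linarith
qed

section \<open>Probability that one random attribute set contains two given attributes\<close>

lemma card_subsets_containing_two_le: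
  fixes a b :: nat
  assumes "finite W" "a \<in> W" "b \<in> W" "a \<noteq> b"
  shows "card {S. S \<subseteq> W \<and> card S = k \<and> a \<in> S \<and> b \<in> S} * (card W)\<^sup>2 \<le> k\<^sup>2 * (card W choose k)"
proof -
  let ?A = "{S. S \<subseteq> W \<and> card S = k \<and> a \<in> S \<and> b \<in> S}"
  let ?B = "{T. T \<subseteq> W - {a, b} \<and> card T = k - 2}"
  have cW: "card (W - {a, b}) = card W - 2"
    using assms by (simp add: card_Diff_subset)
  have "card {a, b} \<le> card W"
    using assms by (intro card_mono) auto
  then have W2: "2 \<le> card W"
    using assms by simp
  have "?A \<subseteq> (\<lambda>T. insert a (insert b T)) ` ?B"
  proof
    fix S assume S: "S \<in> ?A"
    then have "finite S"
      using assms(1) finite_subset by auto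
    then have "S - {a, b} \<in> ?B"
      using S assms by (auto simp: card_Diff_subset)
    moreover have "S = insert a (insert b (S - {a, b}))"
      using S by auto
    ultimately show "S \<in> (\<lambda>T. insert a (insert b T)) ` ?B"
      by blast
  qed
  then have "card ?A \<le> card ?B"
    using assms(1) by (intro surj_card_le) auto
  then have A: "card ?A \<le> (card W - 2) choose (k - 2)"
    using n_subsets[of "W - {a, b}" "k - 2"] assms(1) cW by simp
  show ?thesis
  proof (cases "2 \<le> k \<and> k \<le> card W")
    \<comment> \<open>For k < 2 the truncated \<open>k - 2\<close> makes the binomial bound
      meaningless, and for k > |W| the right-hand side vanishes. In both ranges there are no sets to
      count.\<close>
    case False
    have "?A = {}"
    proof -
      have "2 \<le> card S \<and> card S \<le> card W" if "S \<subseteq> W" "a \<in> S" "b \<in> S" for S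
      proof -
        have "finite S"
          using that assms(1) finite_subset by blast
        then have "card {a, b} \<le> card S"
          using that by (intro card_mono) auto
        then show ?thesis
          using that assms by (auto intro: card_mono)
      qed
      then show ?thesis
        using False by blast
    qed
    show ?thesis
      unfolding \<open>?A = {}\<close> by simp
  next
    case True
    obtain M where M: "card W = Suc (Suc M)"
      using W2 by (metis add_2_eq_Suc le_Suc_ex)
    obtain j where j: "k = Suc (Suc j)"
      using True by (metis add_2_eq_Suc le_Suc_ex)
    have jM: "j \<le> M"
      using True M j by simp
    let ?m = "card W"
    \<comment> \<open>The absorption identity for binomial coefficients, applied twice: the exact
      proportion of such sets is k(k-1) / (m(m-1)), here in multiplied-out form over the
      naturals.\<close>
    have "?m * (?m - 1) * ((?m - 2) choose (k - 2)) = Suc (Suc M) * (Suc M * (M choose j))"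
      by (simp only: M j diff_Suc_1 numeral_2_eq_2 diff_Suc_Suc diff_zero mult.assoc)
    also have "\<dots> = Suc (Suc M) * (Suc j * (Suc M choose Suc j))"
      by (simp only: Suc_times_binomial_eq mult.commute[of _ "Suc j"])
    also have "\<dots> = Suc j * (Suc (Suc M) * (Suc M choose Suc j))"
      by (simp only: mult.left_commute)
    also have "\<dots> = k * (k - 1) * (?m choose k)"
      by (simp only: Suc_times_binomial_eq M j diff_Suc_1 ac_simps)
    finally have eq: "?m * (?m - 1) * ((?m - 2) choose (k - 2)) = k * (k - 1) * (?m choose k)" .
    \<comment> \<open>Since k \<le> m, the ratio (k-1)/(m-1) is at most k/m; this turns the exact
      proportion into k^2 / m^2. The common factor m - 1, positive because m \<ge> 2, is cancelled
      afterwards.\<close>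
    have "(k - 1) * ?m \<le> k * (?m - 1)"
      using jM by (simp add: M j algebra_simps)
    then have "(?m - 1) * (((?m - 2) choose (k - 2)) * ?m\<^sup>2)
        \<le> (?m - 1) * (k\<^sup>2 * (?m choose k))"
    proof -
      have "(?m - 1) * ((?m - 2) choose (k - 2)) * ?m\<^sup>2
          = (?m * (?m - 1) * ((?m - 2) choose (k - 2))) * ?m"
        by (simp add: power2_eq_square ac_simps)
      also have "\<dots> = ((k - 1) * ?m) * (k * (?m choose k))"
        unfolding eq by (simp add: ac_simps)
      also have "\<dots> \<le> (k * (?m - 1)) * (k * (?m choose k))"
        by (rule mult_right_mono) (use \<open>(k - 1) * ?m \<le> k * (?m - 1)\<close> in auto)
      finally show ?thesis
        by (simp add: power2_eq_square ac_simps)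
    qed
    then have "((?m - 2) choose (k - 2)) * ?m\<^sup>2 \<le> k\<^sup>2 * (?m choose k)"
      using M by (simp only: mult_le_cancel1)
    then show ?thesis
      using A by (meson le_trans mult_le_mono1)
  qed
qed

lemma prob_uniform_subset_two_attributes_le:
  assumes "a \<in> {1..m}" "b \<in> {1..m}" "a \<noteq> b" "k \<le> m"
  shows "measure_pmf.prob (pmf_of_set {S. S \<subseteq> {1..m} \<and> card S = k}) {S. a \<in> S \<and> b \<in> S}
           \<le> (real k)\<^sup>2 / (real m)\<^sup>2"
proof -
  let ?U = "{S. S \<subseteq> {1..m} \<and> card S = k}"
  have fin: "finite ?U"
    by simp
  have card_U: "card ?U = m choose k"
    using n_subsets[of "{1..m}" k] by simp
  then have pos: "0 < card ?U"
    using assms by simp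
  then have ne: "?U \<noteq> {}"
    by (metis card.empty less_irrefl)
  have "?U \<inter> {S. a \<in> S \<and> b \<in> S} = {S. S \<subseteq> {1..m} \<and> card S = k \<and> a \<in> S \<and> b \<in> S}"
    by blast
  then have "card (?U \<inter> {S. a \<in> S \<and> b \<in> S}) * m\<^sup>2 \<le> k\<^sup>2 * card ?U"
    using card_subsets_containing_two_le[of "{1..m}" a b k] assms(1-3) unfolding card_U by simp
  then have "real (card (?U \<inter> {S. a \<in> S \<and> b \<in> S})) * (real m)\<^sup>2 \<le> (real k)\<^sup>2 * real (card ?U)"
    by (simp only: of_nat_le_iff flip: of_nat_mult of_nat_power)
  then show ?thesis
    using pos assms by (subst measure_pmf_of_set[OF ne fin]) (simp add: field_simps)
qed

text \<open>Conditioning on the size k reduces to the uniform case, and averaging k^2 / m^2 over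
  \<open>P\<close> produces the second moment. The support condition supplies both k \<le> m and
  integrability.\<close>

lemma prob_attr_two_attributes_le:
  assumes "a \<in> {1..m}" "b \<in> {1..m}" "a \<noteq> b" "set_pmf P \<subseteq> {0..m}"
  shows "measure_pmf.prob (attr_pmf m P) {S. a \<in> S \<and> b \<in> S}
           \<le> measure_pmf.expectation P (\<lambda>k. (real k)\<^sup>2) / (real m)\<^sup>2"
proof -
  have fin: "finite (set_pmf P)"
    using assms(4) finite_subset by blast
  have "measure_pmf.prob (attr_pmf m P) {S. a \<in> S \<and> b \<in> S}
      = measure_pmf.expectation P (\<lambda>k.
          measure_pmf.prob (pmf_of_set {S. S \<subseteq> {1..m} \<and> card S = k}) {S. a \<in> S \<and> b \<in> S})"
    unfolding attr_pmf_def measure_pmf_bind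
    by (rule measure_pmf.measure_bind[where N="count_space UNIV"]) (auto simp: measure_subprob)
  also have "\<dots> \<le> measure_pmf.expectation P (\<lambda>k. (real k)\<^sup>2 / (real m)\<^sup>2)"
    using assms by (intro integral_mono_AE integrable_measure_pmf_finite fin AE_pmfI
        prob_uniform_subset_two_attributes_le) auto
  finally show ?thesis
    by simp
qed

section \<open>Independence, supports and a union bound\<close>

lemma prob_Pi_pmf_coordinates:
  assumes "finite A" "U \<subseteq> A"
  shows "measure_pmf.prob (Pi_pmf A d p) {S. \<forall>y\<in>U. S y \<in> B y}
           = (\<Prod>y\<in>U. measure_pmf.prob (p y) (B y))"
proof -
  \<comment> \<open>Coordinates outside \<open>U\<close> are constrained only to
    \<open>UNIV\<close>, so they contribute factors 1 to the product over \<open>A\<close>.\<close>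
  have "{S. \<forall>y\<in>U. S y \<in> B y} = Pi A (\<lambda>y. if y \<in> U then B y else UNIV)"
    using assms(2) by (auto simp: Pi_def split: if_splits)
  then have "measure_pmf.prob (Pi_pmf A d p) {S. \<forall>y\<in>U. S y \<in> B y}
      = (\<Prod>y\<in>A. measure_pmf.prob (p y) (if y \<in> U then B y else UNIV))"
    using measure_Pi_pmf_Pi[OF assms(1)] by metis
  also have "\<dots> = (\<Prod>y\<in>U. measure_pmf.prob (p y) (B y))"
    using assms by (intro prod.mono_neutral_cong_right) auto
  finally show ?thesis .
qed

lemma set_attr_pmf_subset:
  assumes "set_pmf P \<subseteq> {0..m}"
  shows "set_pmf (attr_pmf m P) \<subseteq> Pow {1..m}"
  unfolding attr_pmf_def set_bind_pmf
proof (rule UN_least)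
  fix k assume "k \<in> set_pmf P"
  then have "k \<le> m"
    using assms by auto
  \<comment> \<open>A witness that the family is nonempty; without one, the support of
    \<open>pmf_of_set\<close> could not be computed.\<close>
  then have "{1..k} \<in> {S. S \<subseteq> {1..m} \<and> card S = k}"
    by simp
  then have "{S. S \<subseteq> {1..m} \<and> card S = k} \<noteq> {}"
    by blast
  then show "set_pmf (pmf_of_set {S. S \<subseteq> {1..m} \<and> card S = k}) \<subseteq> Pow {1..m}"
    by (subst set_pmf_of_set) auto
qed

lemma set_rig_pmf_subset:
  assumes "set_pmf P \<subseteq> {0..m}" "S \<in> set_pmf (rig_pmf n m P)" "v \<in> {1..n}"
  shows "S v \<subseteq> {1..m}"
proof -
  have "S v \<in> set_pmf (attr_pmf m P)"
    using assms(2,3) unfolding rig_pmf_def by (auto simp: set_Pi_pmf PiE_dflt_def)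
  then show ?thesis
    using set_attr_pmf_subset[OF assms(1)] by blast
qed

text \<open>Finite support makes every real function of the random attribute sets integrable, which
  settles the integrability side conditions of the expectations below.\<close>

lemma finite_set_rig_pmf:
  assumes "set_pmf P \<subseteq> {0..m}"
  shows "finite (set_pmf (rig_pmf n m P))"
  unfolding rig_pmf_def
  using set_attr_pmf_subset[OF assms]
  by (auto simp: set_Pi_pmf intro!: finite_PiE_dflt intro: finite_subset)

lemma prob_le_card_mult:
  assumes "finite I" "A \<subseteq> (\<Union>i\<in>I. B i)" "\<And>i. i \<in> I \<Longrightarrow> measure_pmf.prob M (B i) \<le> c"
  shows "measure_pmf.prob M A \<le> real (card I) * c"
proof -
  have "measure_pmf.prob M A \<le> measure_pmf.prob M (\<Union>i\<in>I. B i)"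
    using assms(2) by (intro measure_pmf.finite_measure_mono) auto
  also have "\<dots> \<le> (\<Sum>i\<in>I. measure_pmf.prob M (B i))"
    using assms(1) by (intro measure_pmf.finite_measure_subadditive_finite) auto
  also have "\<dots> \<le> real (card I) * c"
    using assms(3) by (rule sum_bounded_above)
  finally show ?thesis .
qed

section \<open>The expected number of entangled pairs\<close>

lemma prob_shares_two_attributes_le:
  assumes P_supp: "set_pmf P \<subseteq> {0..m}"
    and uv: "u \<in> {1..n}" "v \<in> {1..n}" "u \<noteq> v"
  shows "measure_pmf.prob (rig_pmf n m P) {S. shares_two_attributes {1..m} S u v}
           \<le> (real m)\<^sup>2 * (measure_pmf.expectation P (\<lambda>k. (real k)\<^sup>2) / (real m)\<^sup>2)\<^sup>2"
proof -
  define q where "q = measure_pmf.expectation P (\<lambda>k. (real k)\<^sup>2) / (real m)\<^sup>2"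
  \<comment> \<open>Union bound over at most m^2 ordered pairs of distinct attributes. Both u and v
    must hold a and b, which by independence has probability at most q^2.\<close>
  let ?I = "{(a, b) \<in> {1..m} \<times> {1..m}. a \<noteq> b}"
  let ?B = "\<lambda>(a, b). {S. \<forall>y\<in>{u, v}. S y \<in> {T. a \<in> T \<and> b \<in> T}}"
  have "measure_pmf.prob (rig_pmf n m P) {S. shares_two_attributes {1..m} S u v}
      \<le> real (card ?I) * q\<^sup>2"
  proof (rule prob_le_card_mult)
    show "finite ?I"
      by (rule finite_subset[of _ "{1..m} \<times> {1..m}"]) auto
    show "{S. shares_two_attributes {1..m} S u v} \<subseteq> (\<Union>i\<in>?I. ?B i)"
    proof
      fix S assume "S \<in> {S. shares_two_attributes {1..m} S u v}"
      then obtain a b where "a \<in> {1..m}" "b \<in> {1..m}" "a \<noteq> b"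
        "a \<in> S u" "b \<in> S u" "a \<in> S v" "b \<in> S v"
        unfolding shares_two_attributes_def by blast
      then show "S \<in> (\<Union>i\<in>?I. ?B i)"
        by (intro UN_I[of "(a, b)"]) auto
    qed
    fix i assume "i \<in> ?I"
    then obtain a b where i: "i = (a, b)" and ab: "a \<in> {1..m}" "b \<in> {1..m}" "a \<noteq> b"
      by blast
    have "measure_pmf.prob (rig_pmf n m P) (?B i)
        = (\<Prod>y\<in>{u, v}. measure_pmf.prob (attr_pmf m P) {T. a \<in> T \<and> b \<in> T})"
      unfolding rig_pmf_def i prod.case
      using uv by (intro prob_Pi_pmf_coordinates) auto
    also have "\<dots> \<le> (\<Prod>y\<in>{u, v}. q)"
      unfolding q_def by (intro prod_mono conjI measure_nonneg prob_attr_two_attributes_le ab P_supp)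
    also have "\<dots> = q\<^sup>2"
      using uv(3) by (simp add: power2_eq_square)
    finally show "measure_pmf.prob (rig_pmf n m P) (?B i) \<le> q\<^sup>2" .
  qed
  also have "card ?I \<le> card ({1..m} \<times> {1..m})"
    by (intro card_mono) auto
  then have "real (card ?I) * q\<^sup>2 \<le> (real m)\<^sup>2 * q\<^sup>2"
    by (intro mult_right_mono) (simp_all add: card_cartesian_product power2_eq_square flip: of_nat_mult)
  finally show ?thesis
    by (simp add: q_def)
qed

text \<open>Union bound over n choices of the third vertex and m^3 choices of attributes. For each
  choice three different vertices must each hold two prescribed attributes, so independence gives
  q^3.\<close>

lemma prob_in_rainbow_triangle_le:
  assumes P_supp: "set_pmf P \<subseteq> {0..m}"
    and uv: "u \<in> {1..n}" "v \<in> {1..n}" "u \<noteq> v"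
  shows "measure_pmf.prob (rig_pmf n m P) {S. in_rainbow_triangle {1..n} {1..m} S u v}
           \<le> real n * (real m)^3 * (measure_pmf.expectation P (\<lambda>k. (real k)\<^sup>2) / (real m)\<^sup>2)^3"
proof -
  define q where "q = measure_pmf.expectation P (\<lambda>k. (real k)\<^sup>2) / (real m)\<^sup>2"
  then have q_nonneg: "0 \<le> q"
    by simp
  let ?J = "{1..n} \<times> {1..m} \<times> {1..m} \<times> {1..m}"
  let ?I = "{(x, a, b, c) \<in> ?J. x \<noteq> u \<and> x \<noteq> v \<and> a \<noteq> b \<and> a \<noteq> c \<and> b \<noteq> c}"
  \<comment> \<open>The requirement on each corner: a and b at u, a and c at v, b and c at x. Since
    u, v, x are distinct, the nested conditionals pick the intended set.\<close>
  let ?D = "\<lambda>a b c y. if y = u then {T. a \<in> T \<and> b \<in> T} else if y = v then {T. a \<in> T \<and> c \<in> T}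
              else {T. b \<in> T \<and> c \<in> T}"
  let ?B = "\<lambda>(x, a, b, c). {S. \<forall>y\<in>{u, v, x}. S y \<in> ?D a b c y}"
  have "measure_pmf.prob (rig_pmf n m P) {S. in_rainbow_triangle {1..n} {1..m} S u v}
      \<le> real (card ?I) * q^3"
  proof (rule prob_le_card_mult)
    show "finite ?I"
      by (rule finite_subset[of _ ?J]) auto
    show "{S. in_rainbow_triangle {1..n} {1..m} S u v} \<subseteq> (\<Union>i\<in>?I. ?B i)"
    proof
      fix S assume "S \<in> {S. in_rainbow_triangle {1..n} {1..m} S u v}"
      then obtain x a b c where x: "x \<in> {1..n}" "x \<noteq> u" "x \<noteq> v"
        and abc: "a \<in> {1..m}" "b \<in> {1..m}" "c \<in> {1..m}" "a \<noteq> b" "a \<noteq> c" "b \<noteq> c"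
        and S: "a \<in> S u" "b \<in> S u" "a \<in> S v" "c \<in> S v" "b \<in> S x" "c \<in> S x"
        unfolding in_rainbow_triangle_def mem_Collect_eq by (elim bexE conjE) blast
      have "(x, a, b, c) \<in> ?I"
        using x abc by simp
      moreover have "S \<in> ?B (x, a, b, c)"
        using x S uv(3) by simp
      ultimately show "S \<in> (\<Union>i\<in>?I. ?B i)"
        by (rule UN_I)
    qed
    fix i assume "i \<in> ?I"
    then obtain x a b c where i: "i = (x, a, b, c)" and x: "x \<in> {1..n}" "x \<noteq> u" "x \<noteq> v"
      and abc: "a \<in> {1..m}" "b \<in> {1..m}" "c \<in> {1..m}" "a \<noteq> b" "a \<noteq> c" "b \<noteq> c"
      by blast
    have "measure_pmf.prob (rig_pmf n m P) (?B i)
        = (\<Prod>y\<in>{u, v, x}. measure_pmf.prob (attr_pmf m P) (?D a b c y))"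
      unfolding rig_pmf_def i prod.case
      using uv x by (intro prob_Pi_pmf_coordinates) auto
    also have "\<dots> \<le> (\<Prod>y\<in>{u, v, x}. q)"
    proof (intro prod_mono conjI measure_nonneg)
      fix y
      consider "y = u" | "y \<noteq> u" "y = v" | "y \<noteq> u" "y \<noteq> v"
        by blast
      then show "measure_pmf.prob (attr_pmf m P) (?D a b c y) \<le> q"
        unfolding q_def using prob_attr_two_attributes_le[OF _ _ _ P_supp] abc
        by cases simp_all
    qed
    also have "\<dots> = q^3"
      using uv(3) x by (simp add: power3_eq_cube)
    finally show "measure_pmf.prob (rig_pmf n m P) (?B i) \<le> q^3" .
  qed
  also have "card ?I \<le> card ?J"
    by (intro card_mono) auto
  then have "card ?I \<le> n * m^3"
    by (simp add: card_cartesian_product power3_eq_cube)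
  then have "real (card ?I) \<le> real n * (real m)^3"
    by (simp only: of_nat_le_iff flip: of_nat_mult of_nat_power)
  then have "real (card ?I) * q^3 \<le> real n * (real m)^3 * q^3"
    using q_nonneg by (intro mult_right_mono) auto
  finally show ?thesis
    by (simp add: q_def)
qed

text \<open>Here y is the second moment of Y and equals n m q. Summing over the n^2 ordered pairs
  gives n^2 (m^2 q^2 + n m^3 q^3) = y^2 + y^3.\<close>

lemma expectation_card_entangled_pairs_le:
  fixes n m :: nat and P :: "nat pmf" and y :: real
  defines "y \<equiv> real n / real m * measure_pmf.expectation P (\<lambda>k. (real k)\<^sup>2)"
  assumes P_supp: "set_pmf P \<subseteq> {0..m}"
  shows "measure_pmf.expectation (rig_pmf n m P)
           (\<lambda>S. real (card (entangled_pairs {1..n} {1..m} S))) \<le> y\<^sup>2 + y^3"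
proof -
  define q where "q = measure_pmf.expectation P (\<lambda>k. (real k)\<^sup>2) / (real m)\<^sup>2"
  then have q_nonneg: "0 \<le> q"
    by simp
  let ?M = "rig_pmf n m P"
  let ?N = "entangled_pairs {1..n} {1..m}"
  let ?V = "{1..n} \<times> {1..n}"
  have y: "y = real n * real m * q"
    \<comment> \<open>For m = 0 both sides are 0, because division by zero yields 0.\<close>
    by (cases "m = 0") (simp_all add: y_def q_def power2_eq_square)
  have pair: "measure_pmf.prob ?M {S. p \<in> ?N S} \<le> (real m)\<^sup>2 * q\<^sup>2 + real n * (real m)^3 * q^3"
    if pV: "p \<in> ?V" for p
  proof -
    obtain u v where p: "p = (u, v)" "u \<in> {1..n}" "v \<in> {1..n}"
      using pV by blast
    show ?thesis
    proof (cases "u = v")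
      case True
      then show ?thesis
        using q_nonneg by (simp add: p entangled_pairs_def)
    next
      case False
      have "measure_pmf.prob ?M {S. p \<in> ?N S}
          \<le> measure_pmf.prob ?M ({S. shares_two_attributes {1..m} S u v}
              \<union> {S. in_rainbow_triangle {1..n} {1..m} S u v})"
        by (intro measure_pmf.finite_measure_mono) (auto simp: p entangled_pairs_def)
      also have "\<dots> \<le> measure_pmf.prob ?M {S. shares_two_attributes {1..m} S u v}
          + measure_pmf.prob ?M {S. in_rainbow_triangle {1..n} {1..m} S u v}"
        by (intro measure_Un_le) auto
      also have "\<dots> \<le> (real m)\<^sup>2 * q\<^sup>2 + real n * (real m)^3 * q^3"
        unfolding q_def
        by (intro add_mono prob_shares_two_attributes_le prob_in_rainbow_triangle_le
            P_supp p False)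
      finally show ?thesis .
    qed
  qed
  have "real (card (?N S)) = (\<Sum>p\<in>?V. indicator {S. p \<in> ?N S} S)" for S
  proof -
    have "?N S \<subseteq> ?V"
      by (auto simp: entangled_pairs_def)
    then have "?V \<inter> ?N S = ?N S"
      by blast
    moreover have "(\<Sum>p\<in>?V. indicator {S. p \<in> ?N S} S :: real) = (\<Sum>p\<in>?V. indicator (?N S) p)"
      by (intro sum.cong) (auto simp: indicator_def)
    ultimately show ?thesis
      by (simp add: indicator_def sum.If_cases)
  qed
  then have "measure_pmf.expectation ?M (\<lambda>S. real (card (?N S)))
      = (\<Sum>p\<in>?V. measure_pmf.expectation ?M (indicator {S. p \<in> ?N S}))"
    by (simp only:) (intro Bochner_Integration.integral_sum integrable_measure_pmf_finite
        finite_set_rig_pmf P_supp)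
  also have "\<dots> = (\<Sum>p\<in>?V. measure_pmf.prob ?M {S. p \<in> ?N S})"
    by simp
  also have "\<dots> \<le> real (card ?V) * ((real m)\<^sup>2 * q\<^sup>2 + real n * (real m)^3 * q^3)"
    using pair by (rule sum_bounded_above)
  also have "\<dots> = y\<^sup>2 + y^3"
    by (simp add: card_cartesian_product y algebra_simps power2_eq_square power3_eq_cube)
  finally show ?thesis .
qed

section \<open>Second moment of the clique number on the failure event\<close>

lemma expectation_clique_number_square_defect_le:
  fixes n m :: nat and P :: "nat pmf" and C :: "(nat \<Rightarrow> nat set) \<Rightarrow> nat set" and y :: real
  defines "y \<equiv> real n / real m * measure_pmf.expectation P (\<lambda>k. (real k)\<^sup>2)"
  assumes P_supp: "set_pmf P \<subseteq> {0..m}"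
    and C: "\<And>S. S \<in> set_pmf (rig_pmf n m P) \<Longrightarrow> C S \<in> mono_clique_outputs {1..n} (rig_adj S)"
  shows "measure_pmf.expectation (rig_pmf n m P)
           (\<lambda>S. (real (clique_number {1..n} (rig_adj S)))\<^sup>2
                * indicator {S. card (C S) \<noteq> clique_number {1..n} (rig_adj S)} S)
         \<le> 2 * (y\<^sup>2 + y^3) + 1"
proof -
  let ?M = "rig_pmf n m P"
  let ?N = "\<lambda>S. card (entangled_pairs {1..n} {1..m} S)"
  let ?\<omega> = "\<lambda>S. clique_number {1..n} (rig_adj S)"
  have int: "integrable ?M f" for f :: "(nat \<Rightarrow> nat set) \<Rightarrow> real"
    by (intro integrable_measure_pmf_finite finite_set_rig_pmf P_supp)
  have "measure_pmf.expectation ?M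
      (\<lambda>S. (real (?\<omega> S))\<^sup>2 * indicator {S. card (C S) \<noteq> ?\<omega> S} S)
      \<le> measure_pmf.expectation ?M (\<lambda>S. 2 * real (?N S) + 1)"
  proof (intro integral_mono_AE int AE_pmfI)
    fix S assume S: "S \<in> set_pmf ?M"
    show "(real (?\<omega> S))\<^sup>2 * indicator {S. card (C S) \<noteq> ?\<omega> S} S \<le> 2 * real (?N S) + 1"
    proof (cases "card (C S) = ?\<omega> S")
      case False
      have "(?\<omega> S)\<^sup>2 \<le> 2 * ?N S + 1"
        by (rule clique_number_square_le_entangled_pairs[OF _ set_rig_pmf_subset[OF P_supp S] C[OF S] False])
          auto
      then have "real ((?\<omega> S)\<^sup>2) \<le> real (2 * ?N S + 1)"
        by (simp only: of_nat_le_iff)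
      with False show ?thesis
        by simp
    qed simp
  qed
  also have "\<dots> = 2 * measure_pmf.expectation ?M (\<lambda>S. real (?N S)) + 1"
    by (simp add: int)
  also have "\<dots> \<le> 2 * (y\<^sup>2 + y^3) + 1"
    unfolding y_def by (intro add_mono mult_left_mono order_refl expectation_card_entangled_pairs_le
        P_supp) simp
  finally show ?thesis .
qed

text \<open>The output is a clique, so the difference lies between 0 and the clique number, and it
  is 0 off the failure event.\<close>

lemma expectation_clique_difference_square_le:
  assumes P_supp: "set_pmf P \<subseteq> {0..m}"
    and C: "\<And>S. S \<in> set_pmf (rig_pmf n m P) \<Longrightarrow> C S \<in> mono_clique_outputs {1..n} (rig_adj S)"
  shows "measure_pmf.expectation (rig_pmf n m P)
           (\<lambda>S. (real (clique_number {1..n} (rig_adj S)) - real (card (C S)))\<^sup>2)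
         \<le> measure_pmf.expectation (rig_pmf n m P)
             (\<lambda>S. (real (clique_number {1..n} (rig_adj S)))\<^sup>2
                * indicator {S. card (C S) \<noteq> clique_number {1..n} (rig_adj S)} S)"
proof (intro integral_mono_AE integrable_measure_pmf_finite finite_set_rig_pmf P_supp AE_pmfI)
  fix S assume S: "S \<in> set_pmf (rig_pmf n m P)"
  have "card (C S) \<le> clique_number {1..n} (rig_adj S)"
    by (intro clique_card_le_clique_number mono_clique_output_is_clique[OF symp_rig_adj C[OF S]]) simp
  then show "(real (clique_number {1..n} (rig_adj S)) - real (card (C S)))\<^sup>2
      \<le> (real (clique_number {1..n} (rig_adj S)))\<^sup>2
          * indicator {S. card (C S) \<noteq> clique_number {1..n} (rig_adj S)} S"
    by (auto simp: indicator_def intro!: power_mono)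
qed

text \<open>Markov's inequality for the squared clique number restricted to the failure event: on
  the event in question this variable is at least w^2.\<close>

lemma prob_clique_number_ge_defect_le:
  fixes w :: real
  assumes P_supp: "set_pmf P \<subseteq> {0..m}" and "0 < w"
  shows "measure_pmf.prob (rig_pmf n m P)
           {S. w \<le> real (clique_number {1..n} (rig_adj S)) \<and>
               card (C S) \<noteq> clique_number {1..n} (rig_adj S)}
         \<le> measure_pmf.expectation (rig_pmf n m P)
             (\<lambda>S. (real (clique_number {1..n} (rig_adj S)))\<^sup>2
                * indicator {S. card (C S) \<noteq> clique_number {1..n} (rig_adj S)} S) / w\<^sup>2"
    (is "measure_pmf.prob ?M ?A \<le> measure_pmf.expectation _ ?f / _")
proof -
  have "measure_pmf.prob ?M ?A * w\<^sup>2 = measure_pmf.expectation ?M (\<lambda>S. indicator ?A S * w\<^sup>2)"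
    by simp
  also have "\<dots> \<le> measure_pmf.expectation ?M ?f"
    using assms(2)
    by (intro integral_mono_AE integrable_measure_pmf_finite finite_set_rig_pmf P_supp AE_pmfI)
      (auto simp: indicator_def intro!: power_mono)
  finally show ?thesis
    using assms(2) by (simp add: field_simps)
qed


theorem mainTheorem19:
  fixes m :: "nat \<Rightarrow> nat" and P :: "nat \<Rightarrow> nat pmf"
    and C :: "nat \<Rightarrow> (nat \<Rightarrow> nat set) \<Rightarrow> nat set"
  assumes P_supp: "\<And>n. set_pmf (P n) \<subseteq> {0..m n}"
    and m_inf: "filterlim m at_top sequentially"
    and n_Om: "(\<lambda>n. real n) \<in> O(\<lambda>n. real (m n))"
    and EY2: "(\<lambda>n. measure_pmf.expectation (P n)
                 (\<lambda>x. (sqrt (real n / real (m n)) * real x) ^ 2)) \<in> O(\<lambda>_. 1)"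
    and C_out: "\<And>n S. S \<in> set_pmf (rig_pmf n (m n) (P n)) \<Longrightarrow>
                   C n S \<in> mono_clique_outputs {1..n} (rig_adj S)"
  shows "(\<lambda>n. measure_pmf.expectation (rig_pmf n (m n) (P n))
            (\<lambda>S. (real (clique_number {1..n} (rig_adj S)) - real (card (C n S))) ^ 2))
           \<in> O(\<lambda>_. 1)
    \<and> ((\<exists>w :: nat \<Rightarrow> real. filterlim w at_top sequentially \<and>
          ((\<lambda>n. measure_pmf.prob (rig_pmf n (m n) (P n))
                 {S. real (clique_number {1..n} (rig_adj S)) \<ge> w n}) \<longlonglongrightarrow> 1))
       \<longrightarrow> ((\<lambda>n. measure_pmf.prob (rig_pmf n (m n) (P n))
                 {S. card (C n S) = clique_number {1..n} (rig_adj S)}) \<longlonglongrightarrow> 1))"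
proof -
  define y where "y n = real n / real (m n) * measure_pmf.expectation (P n) (\<lambda>k. (real k)\<^sup>2)" for n
  let ?M = "\<lambda>n. rig_pmf n (m n) (P n)"
  let ?\<omega> = "\<lambda>n S. clique_number {1..n} (rig_adj S)"
  let ?F = "\<lambda>n. measure_pmf.expectation (?M n)
              (\<lambda>S. (real (?\<omega> n S))\<^sup>2 * indicator {S. card (C n S) \<noteq> ?\<omega> n S} S)"
  have y_nonneg: "0 \<le> y n" for n
    by (simp add: y_def)
  have y_eq: "measure_pmf.expectation (P n) (\<lambda>x. (sqrt (real n / real (m n)) * real x) ^ 2) = y n" for n
    by (simp add: y_def power_mult_distrib)
  have "y \<in> O(\<lambda>_. 1)"
    using EY2 unfolding y_eq by simp
  then obtain c where c: "eventually (\<lambda>n. y n \<le> c) sequentially"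
    using y_nonneg by (auto elim!: landau_o.bigE)
  \<comment> \<open>The bound 2 (y^2 + y^3) + 1 is increasing in y \<ge> 0, so its value at c serves
    for all large n.\<close>
  define B where "B = 2 * (c\<^sup>2 + c^3) + 1"
  have F_le: "eventually (\<lambda>n. ?F n \<le> B) sequentially"
    using c
  proof eventually_elim
    case (elim n)
    have "?F n \<le> 2 * ((y n)\<^sup>2 + (y n)^3) + 1"
      unfolding y_def by (intro expectation_clique_number_square_defect_le P_supp C_out)
    also have "\<dots> \<le> B"
      unfolding B_def using elim y_nonneg
      by (intro add_mono mult_left_mono power_mono order_refl) auto
    finally show ?case .
  qed
  have "(\<lambda>n. measure_pmf.expectation (?M n) (\<lambda>S. (real (?\<omega> n S) - real (card (C n S))) ^ 2)) \<in> O(\<lambda>_. 1)"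
  \<comment> \<open>The rule asks for a positive constant, which the maximum with 1 guarantees at
    once.\<close>
  proof (rule landau_o.bigI[of "max 1 B"])
    show "eventually (\<lambda>n. norm (measure_pmf.expectation (?M n)
        (\<lambda>S. (real (?\<omega> n S) - real (card (C n S))) ^ 2)) \<le> max 1 B * norm (1 :: real)) sequentially"
      using F_le
    proof eventually_elim
      case (elim n)
      have "measure_pmf.expectation (?M n) (\<lambda>S. (real (?\<omega> n S) - real (card (C n S))) ^ 2) \<le> ?F n"
        by (intro expectation_clique_difference_square_le P_supp C_out)
      also note elim
      finally have "measure_pmf.expectation (?M n)
          (\<lambda>S. (real (?\<omega> n S) - real (card (C n S))) ^ 2) \<le> B" .
      then show ?case
        by simp
    qed
  qed simp
  moreover have "(\<lambda>n. measure_pmf.prob (?M n) {S. card (C n S) = ?\<omega> n S}) \<longlonglongrightarrow> 1"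
    if w: "filterlim w at_top sequentially"
      and lim: "(\<lambda>n. measure_pmf.prob (?M n) {S. real (?\<omega> n S) \<ge> w n}) \<longlonglongrightarrow> 1"
    for w :: "nat \<Rightarrow> real"
  \<comment> \<open>The success probability is at least the probability that the clique number
    reaches \<open>w n\<close>, minus the probability that it does so and the algorithm fails. The
    latter is at most B / (w n)^2, which tends to 0.\<close>
  proof (rule tendsto_sandwich)
    have "(\<lambda>n. B / (w n)\<^sup>2) \<longlonglongrightarrow> 0"
      by (intro tendsto_divide_0[OF tendsto_const] filterlim_at_top_imp_at_infinity
          filterlim_pow_at_top w) simp
    then show "(\<lambda>n. measure_pmf.prob (?M n) {S. real (?\<omega> n S) \<ge> w n} - B / (w n)\<^sup>2) \<longlonglongrightarrow> 1"
      using tendsto_diff[OF lim] by fastforce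
    have "eventually (\<lambda>n. 0 < w n) sequentially"
      using w by (simp add: filterlim_at_top_dense)
    then show "eventually (\<lambda>n. measure_pmf.prob (?M n) {S. real (?\<omega> n S) \<ge> w n} - B / (w n)\<^sup>2
        \<le> measure_pmf.prob (?M n) {S. card (C n S) = ?\<omega> n S}) sequentially"
      using F_le
    proof eventually_elim
      case (elim n)
      let ?D = "{S. w n \<le> real (?\<omega> n S) \<and> card (C n S) \<noteq> ?\<omega> n S}"
      have "measure_pmf.prob (?M n) {S. real (?\<omega> n S) \<ge> w n}
          \<le> measure_pmf.prob (?M n) ({S. card (C n S) = ?\<omega> n S} \<union> ?D)"
        by (intro measure_pmf.finite_measure_mono) auto
      also have "\<dots> \<le> measure_pmf.prob (?M n) {S. card (C n S) = ?\<omega> n S}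
          + measure_pmf.prob (?M n) ?D"
        by (intro measure_Un_le) auto
      also have "measure_pmf.prob (?M n) ?D \<le> ?F n / (w n)\<^sup>2"
        by (intro prob_clique_number_ge_defect_le P_supp elim)
      also have "\<dots> \<le> B / (w n)\<^sup>2"
        using elim by (intro divide_right_mono) auto
      finally show ?case
        by linarith
    qed
    show "eventually (\<lambda>n. measure_pmf.prob (?M n) {S. card (C n S) = ?\<omega> n S} \<le> 1) sequentially"
      by simp
  qed simp
  ultimately show ?thesis
    by blast
qed

end
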